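(* Let $\sigma>0$. If $u\in\mathcal{C}(\sigma)$, then $u\in E_b$, where $b:=\frac{1}{64\sigma}$.
   Context: Fix $L>0$, $\nu>0$, $\Omega=[0,L]^2$, $\kappa_0=2\pi/L$. $H$ is the closure in $[L^2(\Omega)]^2$ of the $\Omega$-periodic $\mathbb{R}^2$-valued trigonometric polynomials $v$ with $\nabla\cdot v=0$ and $\int_\Omega v\,dx=0$, with $L^2$ norm $|\cdot|$. Elements of $H$ are written $u(x)=\sum_{k\in\mathbb{Z}^2\setminus\{0\}}\hat u(k)e^{i\kappa_0k\cdot x}$, with $|u|^2=L^2\sum_k|\hat u(k)|^2$. $A=-\Delta$ is the Stokes operator on $H$, with $\widehat{A^{s}u}(k)=(\kappa_0|k|)^{2s}\hat u(k)$. For $\sigma>0$, $\mathcal{C}(\sigma)$ is the set of $\Omega$-periodic $C^\infty$ functions $u\in H$ for which there is a constant $c_0=c_0(u)\in\mathbb{R}$ such that $\frac{|A^{\alpha/2}u|^2}{\nu^2\kappa_0^{2\alpha}}\le c_0e^{\sigma\alpha^2}$ for all $\alpha\in\mathbb{N}$. For $b>0$, $E_b$ is the set of $u\in H$ with $|E^bu|<\infty$, where $\widehat{E^bu}(k)=e^{b[\ln(|k|+e)]^2}\hat u(k)$. *)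

theory Defs
  imports "HOL-Analysis.Analysis"
begin

definition Omega :: "real \<Rightarrow> (real^2) set" where
  "Omega L = cbox 0 (\<chi> i. L)"

definition kappa0 :: "real \<Rightarrow> real" where
  "kappa0 L = 2 * pi / L"

definition rvec :: "int^2 \<Rightarrow> real^2" where
  "rvec k = (\<chi> i. real_of_int (k $ i))"

definition periodic_on_Omega :: "real \<Rightarrow> (real^2 \<Rightarrow> real^2) \<Rightarrow> bool" where
  "periodic_on_Omega L u \<longleftrightarrow> (\<forall>x i. u (x + axis i L) = u x)"

definition divergence :: "(real^2 \<Rightarrow> real^2) \<Rightarrow> real^2 \<Rightarrow> real" where
  "divergence v x = (\<Sum>i\<in>UNIV. frechet_derivative v (at x) (axis i 1) $ i)"

definition trig_polynomial :: "real \<Rightarrow> (real^2 \<Rightarrow> real^2) \<Rightarrow> bool" where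
  "trig_polynomial L v \<longleftrightarrow>
     (\<exists>(K :: (int^2) set) (c :: int^2 \<Rightarrow> complex^2). finite K \<and>
        (\<forall>x j. complex_of_real (v x $ j) =
           (\<Sum>k\<in>K. c k $ j * exp (\<i> * complex_of_real (kappa0 L * (rvec k \<bullet> x))))))"

definition solenoidal_trig_polynomials :: "real \<Rightarrow> (real^2 \<Rightarrow> real^2) set" where
  "solenoidal_trig_polynomials L =
     {v. trig_polynomial L v \<and> (\<forall>x. divergence v x = 0) \<and>
         integral\<^sup>L (lebesgue_on (Omega L)) v = 0}"

definition square_integrable :: "real \<Rightarrow> (real^2 \<Rightarrow> real^2) set" where
  "square_integrable L =
     {u. u \<in> borel_measurable (lebesgue_on (Omega L)) \<and>
         integrable (lebesgue_on (Omega L)) (\<lambda>x. (norm (u x))\<^sup>2)}"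

text \<open>Elements of \<open>H\<close> are represented by functions on the plane, of which only the
  restriction to \<open>Omega L\<close>, up to null sets, matters.\<close>

definition space_H :: "real \<Rightarrow> (real^2 \<Rightarrow> real^2) set" where
  "space_H L =
     {u \<in> square_integrable L. \<forall>\<epsilon>>0. \<exists>v\<in>solenoidal_trig_polynomials L.
         sqrt (integral\<^sup>L (lebesgue_on (Omega L)) (\<lambda>x. (norm (u x - v x))\<^sup>2)) < \<epsilon>}"

definition fourier_coeff :: "real \<Rightarrow> (real^2 \<Rightarrow> real^2) \<Rightarrow> int^2 \<Rightarrow> complex^2" where
  "fourier_coeff L u k =
     (\<chi> j. complex_of_real (1 / L\<^sup>2) *
        integral\<^sup>L (lebesgue_on (Omega L))
          (\<lambda>x. complex_of_real (u x $ j) *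
               exp (- (\<i> * complex_of_real (kappa0 L * (rvec k \<bullet> x))))))"

text \<open>The squared norm of the (formal) Fourier series with coefficients \<open>c\<close>, given by
  Parseval's identity; it is infinite if the series does not define an element of \<open>L\<^sup>2\<close>.\<close>

definition norm_sq :: "real \<Rightarrow> (int^2 \<Rightarrow> complex^2) \<Rightarrow> ennreal" where
  "norm_sq L c = ennreal (L\<^sup>2) * (\<Sum>\<^sub>\<infinity>k\<in>UNIV - {0}. ennreal ((norm (c k))\<^sup>2))"

text \<open>Fourier coefficients of \<open>A\<^sup>s u\<close> and \<open>E\<^sup>b u\<close>.\<close>

definition A_pow :: "real \<Rightarrow> real \<Rightarrow> (real^2 \<Rightarrow> real^2) \<Rightarrow> int^2 \<Rightarrow> complex^2" where
  "A_pow L s u k = ((kappa0 L * norm (rvec k)) powr (2 * s)) *\<^sub>R fourier_coeff L u k"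

definition E_pow :: "real \<Rightarrow> real \<Rightarrow> (real^2 \<Rightarrow> real^2) \<Rightarrow> int^2 \<Rightarrow> complex^2" where
  "E_pow L b u k = exp (b * (ln (norm (rvec k) + exp 1))\<^sup>2) *\<^sub>R fourier_coeff L u k"

primrec C_k :: "nat \<Rightarrow> (real^2 \<Rightarrow> real^2) \<Rightarrow> bool" where
  "C_k 0 f \<longleftrightarrow> continuous_on UNIV f"
| "C_k (Suc n) f \<longleftrightarrow> f differentiable_on UNIV \<and>
     (\<forall>i. C_k n (\<lambda>x. frechet_derivative f (at x) (axis i 1)))"

definition C_infinity :: "(real^2 \<Rightarrow> real^2) \<Rightarrow> bool" where
  "C_infinity f \<longleftrightarrow> (\<forall>n. C_k n f)"

text \<open>The inequality is between extended nonnegative reals; a negative \<open>c0\<close>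
  is truncated to a zero bound, which \<open>c0 = 0\<close> gives as well.\<close>

definition class_C :: "real \<Rightarrow> real \<Rightarrow> real \<Rightarrow> (real^2 \<Rightarrow> real^2) set" where
  "class_C L \<nu> \<sigma> =
     {u \<in> space_H L. periodic_on_Omega L u \<and> C_infinity u \<and>
        (\<exists>c0::real. \<forall>\<alpha>::nat.
           norm_sq L (A_pow L (real \<alpha> / 2) u) / ennreal (\<nu>\<^sup>2 * kappa0 L ^ (2 * \<alpha>))
             \<le> ennreal (c0 * exp (\<sigma> * (real \<alpha>)\<^sup>2)))}"

definition space_E :: "real \<Rightarrow> real \<Rightarrow> (real^2 \<Rightarrow> real^2) set" where
  "space_E L b = {u \<in> space_H L. norm_sq L (E_pow L b u) < \<infinity>}"

end

theory Submission
  imports Defs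
begin

text \<open>With \<open>t = ln |k|\<close>, the exponent \<open>2 \<alpha> t - 2 \<sigma> \<alpha>\<^sup>2\<close> is maximal at \<open>\<alpha> = t / (2 \<sigma>)\<close>, where it equals
  \<open>t\<^sup>2 / (2 \<sigma>)\<close>; rounding \<open>\<alpha>\<close> to an integer costs only a constant. Hence the weight of \<open>E\<^sup>b\<close> satisfies
  \<open>exp (2 b (ln (|k| + e))\<^sup>2) \<le> C exp (- 2 \<sigma> \<alpha>\<^sup>2) |k|\<^bsup>2\<alpha>\<^esup>\<close> for a suitable \<open>\<alpha>\<close> depending on \<open>k\<close>. Summing over
  \<open>k\<close>, and bounding the contribution of each \<open>\<alpha>\<close> by the assumption on \<open>A\<^bsup>\<alpha>/2\<^esup> u\<close>, leaves the convergent
  series of the \<open>exp (- \<sigma> \<alpha>\<^sup>2)\<close>.\<close>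

text \<open>The constant has two sources: \<open>1 / (4 * \<sigma>)\<close> pays for passing from
  \<open>ln (r + exp 1)\<close> to \<open>ln r\<close>, and \<open>2 * \<sigma>\<close> pays for
  rounding the optimal exponent to an integer.\<close>

lemma exp_ln_sq_le_power:
  fixes \<sigma> r :: real
  assumes "\<sigma> > 0" and "r \<ge> 1"
  shows "\<exists>n::nat. exp ((ln (r + exp 1))\<^sup>2 / (32 * \<sigma>))
           \<le> exp (1 / (4 * \<sigma>) + 2 * \<sigma>) * (exp (- 2 * \<sigma> * (real n)\<^sup>2) * r ^ (2 * n))"
proof -
  define t where "t = ln r"
  have t0: "t \<ge> 0" and rt: "r = exp t"
    using assms by (simp_all add: t_def)
  define n where "n = nat \<lfloor>t / (2 * \<sigma>)\<rfloor>"
  define \<delta> where "\<delta> = t / (2 * \<sigma>) - real n"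
  have "real n = of_int \<lfloor>t / (2 * \<sigma>)\<rfloor>"
    using t0 assms by (simp add: n_def)
  then have d: "0 \<le> \<delta>" "\<delta> \<le> 1"
    unfolding \<delta>_def by linarith+
  have e2: "exp 2 = exp 1 * (exp 1 :: real)"
    by (simp flip: exp_add)
  have e: "exp (1::real) \<ge> 2"
    using exp_ge_add_one_self[of 1] by simp
  \<comment> \<open>Aim: \<open>r + exp 1 \<le> r * exp 2\<close>, so that the shift by
    \<open>exp 1\<close> costs only an additive 2 in the logarithm. It follows from 1 + e \<le> 2 e
    \<le> e * e and \<open>r \<ge> 1\<close>.\<close>
  have "exp (1::real) * 2 \<le> exp 1 * exp 1"
    using e by (intro mult_left_mono) auto
  then have "1 + exp 1 \<le> exp (2::real)"
    using e unfolding e2 by linarith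
  then have "r * (1 + exp 1) \<le> r * exp 2"
    using assms by (intro mult_left_mono) auto
  moreover have "1 * exp 1 \<le> r * exp 1"
    using assms by (intro mult_right_mono) auto
  ultimately have "r + exp 1 \<le> r * exp 2"
    unfolding distrib_left by linarith
  then have "r + exp 1 \<le> exp (t + 2)"
    by (simp add: exp_add rt)
  then have "ln (r + exp 1) \<le> t + 2"
    using assms by (metis add_pos_pos exp_gt_zero less_le_trans ln_exp ln_le_cancel_iff zero_less_one)
  moreover have "0 \<le> ln (r + exp 1)"
    using assms e by simp
  ultimately have "(ln (r + exp 1))\<^sup>2 \<le> (t + 2)\<^sup>2"
    by (simp add: power_mono)
  also have "\<dots> \<le> 2 * t\<^sup>2 + 8"
    using zero_le_power2[of "t - 2"] by (simp add: power2_eq_square algebra_simps)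
  finally have "(ln (r + exp 1))\<^sup>2 / (32 * \<sigma>) \<le> (2 * t\<^sup>2 + 8) / (32 * \<sigma>)"
    using assms by (intro divide_right_mono) auto
  moreover have "(2 * t\<^sup>2 + 8) / (32 * \<sigma>) = t\<^sup>2 / (16 * \<sigma>) + 1 / (4 * \<sigma>)"
    using assms by (simp add: field_simps)
  \<comment> \<open>A factor 8 is given away here; the maximum
    \<open>t\<^sup>2 / (2 * \<sigma>)\<close> is what the choice of \<open>n\<close> attains up to
    rounding.\<close>
  moreover have "t\<^sup>2 / (16 * \<sigma>) \<le> t\<^sup>2 / (2 * \<sigma>)"
    using assms by (intro divide_left_mono) auto
  \<comment> \<open>Completing the square, with t = 2 \<sigma> (n + \<delta>).\<close>
  moreover have "t\<^sup>2 / (2 * \<sigma>) = 2 * \<sigma> * \<delta>\<^sup>2 - 2 * \<sigma> * (real n)\<^sup>2 + real (2 * n) * t"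
    using assms by (simp add: \<delta>_def power2_eq_square field_simps)
  moreover have "\<sigma> * \<delta>\<^sup>2 \<le> \<sigma> * 1"
    using assms d by (intro mult_left_mono) (auto simp: power_le_one)
  ultimately have "(ln (r + exp 1))\<^sup>2 / (32 * \<sigma>)
      \<le> (1 / (4 * \<sigma>) + 2 * \<sigma>) + (- 2 * \<sigma> * (real n)\<^sup>2 + real (2 * n) * t)"
    by linarith
  then have "exp ((ln (r + exp 1))\<^sup>2 / (32 * \<sigma>))
      \<le> exp ((1 / (4 * \<sigma>) + 2 * \<sigma>) + (- 2 * \<sigma> * (real n)\<^sup>2 + real (2 * n) * t))"
    by simp
  also have "\<dots> = exp (1 / (4 * \<sigma>) + 2 * \<sigma>) * (exp (- 2 * \<sigma> * (real n)\<^sup>2) * r ^ (2 * n))"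
    unfolding exp_add rt exp_of_nat_mult ..
  finally show ?thesis by blast
qed

lemma summable_exp_neg_sq:
  fixes \<sigma> :: real
  assumes "\<sigma> > 0"
  shows "summable (\<lambda>n::nat. exp (- \<sigma> * (real n)\<^sup>2))"
proof (rule summable_comparison_test')
  show "summable (\<lambda>n. exp (- \<sigma>) ^ n)"
    using assms by (intro summable_geometric) auto
  fix n :: nat
  have "real n \<le> (real n)\<^sup>2"
    by (metis of_nat_le_iff of_nat_power power2_nat_le_imp_le le_refl power2_eq_square le_square)
  then have "\<sigma> * real n \<le> \<sigma> * (real n)\<^sup>2"
    using assms by (intro mult_left_mono) auto
  then show "norm (exp (- \<sigma> * (real n)\<^sup>2)) \<le> exp (- \<sigma>) ^ n"
    by (simp flip: exp_of_nat_mult add: mult.commute)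
qed

text \<open>The bound is the same for every finite \<open>F\<close>, which is what allows the later
  passage to all frequencies. The exponent depends on \<open>k\<close>, so the sum is reorganised by
  exponents before \<open>bound\<close> is applied to each of them.\<close>

lemma sum_exp_ln_sq_bounded:
  fixes r a :: "'a \<Rightarrow> real" and \<sigma> M :: real
  assumes \<sigma>: "\<sigma> > 0" and F: "finite F"
    and r: "\<And>k. k \<in> F \<Longrightarrow> r k \<ge> 1" and a: "\<And>k. k \<in> F \<Longrightarrow> a k \<ge> 0" and M: "M \<ge> 0"
    and bound: "\<And>n::nat. (\<Sum>k\<in>F. r k ^ (2 * n) * a k) \<le> M * exp (\<sigma> * (real n)\<^sup>2)"
  shows "(\<Sum>k\<in>F. exp ((ln (r k + exp 1))\<^sup>2 / (32 * \<sigma>)) * a k)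
           \<le> exp (1 / (4 * \<sigma>) + 2 * \<sigma>) * M * (\<Sum>n. exp (- \<sigma> * (real n)\<^sup>2))"
proof -
  define C where "C = exp (1 / (4 * \<sigma>) + 2 * \<sigma>)"
  define w :: "nat \<Rightarrow> real" where "w n = exp (- 2 * \<sigma> * (real n)\<^sup>2)" for n
  have C: "C > 0" by (simp add: C_def)
  have w: "w n \<ge> 0" for n by (simp add: w_def)
  have "\<forall>k\<in>F. \<exists>n. exp ((ln (r k + exp 1))\<^sup>2 / (32 * \<sigma>)) \<le> C * (w n * r k ^ (2 * n))"
    using exp_ln_sq_le_power[OF \<sigma> r] unfolding C_def w_def by blast
  then obtain N where N:
    "\<And>k. k \<in> F \<Longrightarrow> exp ((ln (r k + exp 1))\<^sup>2 / (32 * \<sigma>)) \<le> C * (w (N k) * r k ^ (2 * N k))"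
    by metis
  \<comment> \<open>The one term with \<open>n = N k\<close> is enlarged to a sum over all chosen
    exponents. This index set no longer depends on \<open>k\<close>, so the two sums can be
    swapped.\<close>
  have term_le: "exp ((ln (r k + exp 1))\<^sup>2 / (32 * \<sigma>)) * a k
      \<le> (\<Sum>n\<in>N ` F. C * w n * (r k ^ (2 * n) * a k))" if k: "k \<in> F" for k
  proof -
    have "exp ((ln (r k + exp 1))\<^sup>2 / (32 * \<sigma>)) * a k \<le> C * (w (N k) * r k ^ (2 * N k)) * a k"
      using N[OF k] a[OF k] by (rule mult_right_mono)
    also have "\<dots> = C * w (N k) * (r k ^ (2 * N k) * a k)"
      by simp
    also have "\<dots> \<le> (\<Sum>n\<in>N ` F. C * w n * (r k ^ (2 * n) * a k))"
      using k F C w a[OF k] r[OF k]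
      by (intro member_le_sum[where f = "\<lambda>n. C * w n * (r k ^ (2 * n) * a k)"]) auto
    finally show ?thesis .
  qed
  have "(\<Sum>k\<in>F. exp ((ln (r k + exp 1))\<^sup>2 / (32 * \<sigma>)) * a k)
      \<le> (\<Sum>k\<in>F. \<Sum>n\<in>N ` F. C * w n * (r k ^ (2 * n) * a k))"
    by (intro sum_mono term_le)
  also have "\<dots> = (\<Sum>n\<in>N ` F. C * w n * (\<Sum>k\<in>F. r k ^ (2 * n) * a k))"
    by (subst sum.swap) (simp add: sum_distrib_left)
  also have "\<dots> \<le> (\<Sum>n\<in>N ` F. C * w n * (M * exp (\<sigma> * (real n)\<^sup>2)))"
    using C w by (intro sum_mono mult_left_mono bound) auto
  \<comment> \<open>The growth exp (\<sigma> n^2) from \<open>bound\<close> uses up half of the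
    decay exp (- 2 \<sigma> n^2) in \<open>w\<close>.\<close>
  also have "\<dots> = C * M * (\<Sum>n\<in>N ` F. exp (- \<sigma> * (real n)\<^sup>2))"
    unfolding sum_distrib_left w_def
    by (intro sum.cong refl) (simp add: mult_ac flip: exp_add)
  also have "\<dots> \<le> C * M * (\<Sum>n. exp (- \<sigma> * (real n)\<^sup>2))"
    using C M F summable_exp_neg_sq[OF \<sigma>] by (intro mult_left_mono sum_le_suminf) auto
  finally show ?thesis unfolding C_def .
qed

lemma norm_rvec_ge_1:
  assumes "k \<noteq> 0"
  shows "norm (rvec k) \<ge> 1"
proof -
  obtain i where "k $ i \<noteq> 0"
    using assms by (auto simp: vec_eq_iff)
  then have "1 \<le> \<bar>rvec k $ i\<bar>"
    by (simp add: rvec_def)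
  also have "\<dots> \<le> norm (rvec k)"
    by (rule component_le_norm_cart)
  finally show ?thesis .
qed

text \<open>An infinite sum in \<open>ennreal\<close> is the supremum of its finite partial sums.
  This turns the assumption on \<open>u\<close> into inequalities between reals; the next lemma uses
  the same fact to return.\<close>

lemma finite_sum_le_norm_sq:
  assumes "finite F" and "F \<subseteq> UNIV - {0}"
  shows "ennreal (L\<^sup>2 * (\<Sum>k\<in>F. (norm (c k))\<^sup>2)) \<le> norm_sq L c"
proof -
  have "ennreal (\<Sum>k\<in>F. (norm (c k))\<^sup>2) = (\<Sum>k\<in>F. ennreal ((norm (c k))\<^sup>2))"
    by (simp add: sum_ennreal)
  also have "\<dots> \<le> (\<Sum>\<^sub>\<infinity>k\<in>UNIV - {0}. ennreal ((norm (c k))\<^sup>2))"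
    using assms by (subst nonneg_infsum_complete) (auto intro: SUP_upper)
  finally show ?thesis
    unfolding norm_sq_def by (subst ennreal_mult) (auto intro: mult_left_mono sum_nonneg)
qed

lemma norm_sq_finiteI:
  assumes "\<And>F. finite F \<Longrightarrow> F \<subseteq> UNIV - {0} \<Longrightarrow> (\<Sum>k\<in>F. (norm (c k))\<^sup>2) \<le> B"
  shows "norm_sq L c < \<infinity>"
proof -
  have "(\<Sum>\<^sub>\<infinity>k\<in>UNIV - {0}. ennreal ((norm (c k))\<^sup>2)) \<le> ennreal B"
    using assms
    by (subst nonneg_infsum_complete) (auto intro!: SUP_least ennreal_leI simp: sum_ennreal)
  then show ?thesis
    unfolding norm_sq_def by (simp add: ennreal_mult_less_top le_less_trans)
qed

theorem theorem5p4:
  fixes L \<nu> \<sigma> :: real and u :: "real^2 \<Rightarrow> real^2"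
  assumes "L > 0" and "\<nu> > 0" and "\<sigma> > 0"
    and "u \<in> class_C L \<nu> \<sigma>"
  shows "u \<in> space_E L (1 / (64 * \<sigma>))"
proof -
  define r where "r k = norm (rvec k)" for k
  define a where "a k = (norm (fourier_coeff L u k))\<^sup>2" for k
  have kappa: "kappa0 L > 0"
    using assms by (simp add: kappa0_def)
  obtain c0 where uH: "u \<in> space_H L" and c0: "\<And>n::nat.
      norm_sq L (A_pow L (real n / 2) u) / ennreal (\<nu>\<^sup>2 * kappa0 L ^ (2 * n))
        \<le> ennreal (c0 * exp (\<sigma> * (real n)\<^sup>2))"
    using assms(4) unfolding class_C_def by blast
  \<comment> \<open>\<open>c0\<close> may be negative, and \<open>ennreal\<close> would truncate the
    bound to zero; \<open>max c0 0\<close> makes the return to real inequalities sound.\<close>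
  define M where "M = \<nu>\<^sup>2 * max c0 0 / L\<^sup>2"
  have M: "M \<ge> 0" by (simp add: M_def)
  have r1: "r k \<ge> 1" if "k \<in> F" "F \<subseteq> UNIV - {0}" for k F
    using that norm_rvec_ge_1 by (auto simp: r_def)
  have bound: "(\<Sum>k\<in>F. r k ^ (2 * n) * a k) \<le> M * exp (\<sigma> * (real n)\<^sup>2)"
    if F: "finite F" "F \<subseteq> UNIV - {0}" for F and n :: nat
  proof -
    define S where "S = (\<Sum>k\<in>F. r k ^ (2 * n) * a k)"
    define D where "D = \<nu>\<^sup>2 * kappa0 L ^ (2 * n)"
    have D: "D > 0" using kappa assms by (simp add: D_def)
    have "(norm (A_pow L (real n / 2) u k))\<^sup>2 = kappa0 L ^ (2 * n) * (r k ^ (2 * n) * a k)"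
      if "k \<in> F" for k
    proof -
      have "kappa0 L * r k > 0" using kappa r1[OF that F(2)] by simp
      then show ?thesis
        by (simp add: A_pow_def a_def powr_realpow power_mult_distrib mult.commute
            flip: r_def power_mult)
    qed
    then have sumA: "(\<Sum>k\<in>F. (norm (A_pow L (real n / 2) u k))\<^sup>2) = kappa0 L ^ (2 * n) * S"
      by (simp add: S_def sum_distrib_left)
    have S0: "S \<ge> 0"
      unfolding S_def by (intro sum_nonneg) (simp add: r_def a_def)
    have "ennreal (L\<^sup>2 * (kappa0 L ^ (2 * n) * S) / D)
        = ennreal (L\<^sup>2 * (kappa0 L ^ (2 * n) * S)) / ennreal D"
      using D S0 kappa by (intro divide_ennreal[symmetric]) auto
    also have "\<dots> \<le> norm_sq L (A_pow L (real n / 2) u) / ennreal D"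
      using finite_sum_le_norm_sq[OF F, of L "A_pow L (real n / 2) u"] unfolding sumA
      by (rule divide_right_mono_ennreal)
    also have "\<dots> \<le> ennreal (c0 * exp (\<sigma> * (real n)\<^sup>2))"
      unfolding D_def by (rule c0)
    also have "\<dots> \<le> ennreal (max c0 0 * exp (\<sigma> * (real n)\<^sup>2))"
      by (intro ennreal_leI mult_right_mono) auto
    finally have "L\<^sup>2 * (kappa0 L ^ (2 * n) * S) / D \<le> max c0 0 * exp (\<sigma> * (real n)\<^sup>2)"
      by (subst (asm) ennreal_le_iff) auto
    \<comment> \<open>The powers of \<open>kappa0 L\<close> from \<open>A_pow\<close> and from the
      normalisation cancel, so \<open>M\<close> does not depend on \<open>n\<close>.\<close>
    moreover have "L\<^sup>2 * (kappa0 L ^ (2 * n) * S) / D = L\<^sup>2 * S / \<nu>\<^sup>2"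
      using kappa by (simp add: D_def)
    ultimately have "L\<^sup>2 * S / \<nu>\<^sup>2 \<le> max c0 0 * exp (\<sigma> * (real n)\<^sup>2)"
      by simp
    then have "S \<le> M * exp (\<sigma> * (real n)\<^sup>2)"
      using assms by (simp add: M_def field_simps)
    then show ?thesis unfolding S_def .
  qed
  \<comment> \<open>Squaring the norm doubles the exponent, which turns 1/64 into 1/32.\<close>
  have "(norm (E_pow L (1 / (64 * \<sigma>)) u k))\<^sup>2 = exp ((ln (r k + exp 1))\<^sup>2 / (32 * \<sigma>)) * a k" for k
    by (simp add: E_pow_def a_def power_mult_distrib flip: r_def exp_double)
  then have "(\<Sum>k\<in>F. (norm (E_pow L (1 / (64 * \<sigma>)) u k))\<^sup>2)
      \<le> exp (1 / (4 * \<sigma>) + 2 * \<sigma>) * M * (\<Sum>n. exp (- \<sigma> * (real n)\<^sup>2))"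
    if F: "finite F" "F \<subseteq> UNIV - {0}" for F
    using sum_exp_ln_sq_bounded[OF assms(3) F(1) r1[OF _ F(2)] _ M bound[OF F]]
    by (simp add: a_def)
  then have "norm_sq L (E_pow L (1 / (64 * \<sigma>)) u) < \<infinity>"
    by (rule norm_sq_finiteI)
  with uH show ?thesis
    unfolding space_E_def by simp
qed

end
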